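(* For each integer $k\geq 1$, let $G_k$ be the graph with vertex set $$V(G_k) = \{w, v_1, v_2, v_3,v_4, v_5\} \cup \bigcup_{i = 1}^{k} \{x_i, y_i, z_i\}$$ (all $3k+6$ listed vertices being distinct) and edge set $$E(G_k) = \{wv_1, v_1v_2, v_2v_3, v_3v_4, v_4v_5, v_5v_1\} \cup \bigcup_{i = 1}^{k} \{wz_i, x_iz_i, y_iz_i\}.$$ Then the vertices $v_1$, $v_2$, $v_5$ and $x_i$, $y_i$ for all $i \in \{1, \dots, k\}$ are proper-min-forced in $G_k$. Consequently, $G_k$ is a graph with $n=3k+6$ vertices and $2k+3=\frac{2n}{3}-1$ proper-min-forced vertices.
   Context: All graphs are simple, finite and undirected. $N[v]$ is the closed neighbourhood of a vertex $v$. Distinct vertices $u,v$ are closed twins if $N[u]=N[v]$; a graph is closed-twin-free if it has no closed twins. A nonempty set $S\subseteq V(G)$ is called a code; for $v\in V(G)$ let $I(S;v)=S\cap N[v]$. A code $S$ is an identifying code in $G$ if $I(S;v)\neq\emptyset$ for all $v\in V(G)$ and $I(S;u)\neq I(S;v)$ for all distinct $u,v\in V(G)$. A minimum identifying code is an identifying code of the smallest cardinality. In a closed-twin-free graph $G$, a vertex is always-forced if it belongs to every identifying code in $G$; it is min-forced if it belongs to every minimum identifying code in $G$; it is proper-min-forced if it is min-forced but not always-forced. *)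

theory Defs
  imports Complex_Main
begin

record 'a ugraph =
  verts :: "'a set"
  edges :: "'a set set"

definition simple_graph :: "'a ugraph \<Rightarrow> bool" where
  "simple_graph G \<longleftrightarrow> finite (verts G) \<and>
     (\<forall>e\<in>edges G. \<exists>u\<in>verts G. \<exists>v\<in>verts G. u \<noteq> v \<and> e = {u, v})"

definition closed_nbhd :: "'a ugraph \<Rightarrow> 'a \<Rightarrow> 'a set" where
  "closed_nbhd G v = {u \<in> verts G. u = v \<or> {u, v} \<in> edges G}"

definition closed_twins :: "'a ugraph \<Rightarrow> 'a \<Rightarrow> 'a \<Rightarrow> bool" where
  "closed_twins G u v \<longleftrightarrow>
     u \<in> verts G \<and> v \<in> verts G \<and> u \<noteq> v \<and> closed_nbhd G u = closed_nbhd G v"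

definition closed_twin_free :: "'a ugraph \<Rightarrow> bool" where
  "closed_twin_free G \<longleftrightarrow> (\<nexists>u v. closed_twins G u v)"

definition is_code :: "'a ugraph \<Rightarrow> 'a set \<Rightarrow> bool" where
  "is_code G S \<longleftrightarrow> S \<noteq> {} \<and> S \<subseteq> verts G"

definition I_set :: "'a ugraph \<Rightarrow> 'a set \<Rightarrow> 'a \<Rightarrow> 'a set" where
  "I_set G S v = S \<inter> closed_nbhd G v"

definition identifying_code :: "'a ugraph \<Rightarrow> 'a set \<Rightarrow> bool" where
  "identifying_code G S \<longleftrightarrow> is_code G S \<and>
     (\<forall>v\<in>verts G. I_set G S v \<noteq> {}) \<and>
     (\<forall>u\<in>verts G. \<forall>v\<in>verts G. u \<noteq> v \<longrightarrow> I_set G S u \<noteq> I_set G S v)"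

definition minimum_identifying_code :: "'a ugraph \<Rightarrow> 'a set \<Rightarrow> bool" where
  "minimum_identifying_code G S \<longleftrightarrow> identifying_code G S \<and>
     (\<forall>T. identifying_code G T \<longrightarrow> card S \<le> card T)"

(* The three notions below are only meaningful for closed-twin-free graphs:
   other graphs have no identifying code at all. *)

definition always_forced :: "'a ugraph \<Rightarrow> 'a \<Rightarrow> bool" where
  "always_forced G v \<longleftrightarrow> v \<in> verts G \<and> (\<forall>S. identifying_code G S \<longrightarrow> v \<in> S)"

definition min_forced :: "'a ugraph \<Rightarrow> 'a \<Rightarrow> bool" where
  "min_forced G v \<longleftrightarrow> v \<in> verts G \<and> (\<forall>S. minimum_identifying_code G S \<longrightarrow> v \<in> S)"

definition proper_min_forced :: "'a ugraph \<Rightarrow> 'a \<Rightarrow> bool" where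
  "proper_min_forced G v \<longleftrightarrow> min_forced G v \<and> \<not> always_forced G v"

datatype vertex = W | V nat | X nat | Y nat | Z nat

definition G_fam :: "nat \<Rightarrow> vertex ugraph" where
  "G_fam k = \<lparr>
     verts = {W, V 1, V 2, V 3, V 4, V 5} \<union> (\<Union>i\<in>{1..k}. {X i, Y i, Z i}),
     edges = {{W, V 1}, {V 1, V 2}, {V 2, V 3}, {V 3, V 4}, {V 4, V 5}, {V 5, V 1}}
       \<union> (\<Union>i\<in>{1..k}. {{W, Z i}, {X i, Z i}, {Y i, Z i}})\<rparr>"

end

theory Submission
  imports Defs
begin

text \<open>Every identifying code has at least two vertices in each triple \<open>X i, Y i, Z i\<close> and at least
  three on the five-cycle, hence at least \<open>2 k + 3\<close> in total. Equality excludes \<open>W\<close>; without \<open>W\<close>,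
  separating \<open>Z i\<close> from \<open>X i\<close> and from \<open>Y i\<close> forces \<open>Y i\<close> and \<open>X i\<close>. Then no \<open>Z i\<close> is
  left over, so \<open>W\<close> must be dominated by \<open>V 1\<close>, and separating \<open>W\<close> from the cycle leaves only
  \<open>V 2\<close> and \<open>V 5\<close> for the other two cycle vertices: the minimum code is unique. On the other hand
  any two closed neighbourhoods differ in at least two vertices, so deleting a single vertex from
  the vertex set gives an identifying code, and no vertex is always-forced.\<close>

text \<open>Closed twins have the same \<open>I_set\<close> for every code, so no code separates
  them.\<close>

lemma identifying_code_imp_closed_twin_free:
  assumes "identifying_code G S"
  shows "closed_twin_free G"
  using assms by (auto simp: identifying_code_def closed_twin_free_def closed_twins_def I_set_def)

lemma unique_minimum_code_min_forced_iff:
  assumes "\<And>T. minimum_identifying_code G T \<longleftrightarrow> T = S"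
  shows "min_forced G v \<longleftrightarrow> v \<in> S"
proof -
  have "S \<subseteq> verts G"
    using assms[of S] by (simp add: minimum_identifying_code_def identifying_code_def is_code_def)
  then show ?thesis
    by (auto simp: min_forced_def assms)
qed

section \<open>Structure of the graphs \<open>G_fam k\<close>\<close>

lemma verts_G_fam:
  "verts (G_fam k) = {W, V 1, V 2, V 3, V 4, V 5} \<union> (\<Union>i\<in>{1..k}. {X i, Y i, Z i})"
  by (simp add: G_fam_def)

lemma verts_G_fam_cases:
  assumes "u \<in> verts (G_fam k)"
  obtains "u = W" | "u = V 1" | "u = V 2" | "u = V 3" | "u = V 4" | "u = V 5"
    | i where "i \<in> {1..k}" "u = X i" | i where "i \<in> {1..k}" "u = Y i"
    | i where "i \<in> {1..k}" "u = Z i"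
  using assms unfolding verts_G_fam by blast

lemma simple_graph_G_fam: "simple_graph (G_fam k)"
  unfolding simple_graph_def
proof
  show "finite (verts (G_fam k))"
    by (simp add: verts_G_fam)
  show "\<forall>e\<in>edges (G_fam k). \<exists>u\<in>verts (G_fam k). \<exists>v\<in>verts (G_fam k). u \<noteq> v \<and> e = {u, v}"
    (is "\<forall>e\<in>_. ?P e")
  proof
    fix e assume "e \<in> edges (G_fam k)"
    then consider "e \<in> {{W, V 1}, {V 1, V 2}, {V 2, V 3}, {V 3, V 4}, {V 4, V 5}, {V 5, V 1}}"
      | i where "i \<in> {1..k}" "e \<in> {{W, Z i}, {X i, Z i}, {Y i, Z i}}"
      unfolding G_fam_def by auto
    moreover have P: "?P {u, v}" if "u \<in> verts (G_fam k)" "v \<in> verts (G_fam k)" "u \<noteq> v" for u v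
      using that by blast
    ultimately show "?P e"
    proof cases
      case 1
      then show ?thesis
        by (elim insertE emptyE; hypsubst; intro P) (simp_all add: verts_G_fam)
    next
      case 2
      then show ?thesis
        by (elim insertE emptyE; hypsubst; intro P) (auto simp: verts_G_fam)
    qed
  qed
qed

lemma closed_nbhd_G_fam:
  "closed_nbhd (G_fam k) W = {W, V 1} \<union> Z ` {1..k}"
  "closed_nbhd (G_fam k) (V 1) = {V 1, W, V 2, V 5}"
  "closed_nbhd (G_fam k) (V 2) = {V 1, V 2, V 3}"
  "closed_nbhd (G_fam k) (V 3) = {V 2, V 3, V 4}"
  "closed_nbhd (G_fam k) (V 4) = {V 3, V 4, V 5}"
  "closed_nbhd (G_fam k) (V 5) = {V 4, V 5, V 1}"
  "i \<in> {1..k} \<Longrightarrow> closed_nbhd (G_fam k) (X i) = {X i, Z i}"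
  "i \<in> {1..k} \<Longrightarrow> closed_nbhd (G_fam k) (Y i) = {Y i, Z i}"
  "i \<in> {1..k} \<Longrightarrow> closed_nbhd (G_fam k) (Z i) = {Z i, X i, Y i, W}"
  unfolding closed_nbhd_def G_fam_def by (auto simp: doubleton_eq_iff)

lemma card_verts_G_fam: "card (verts (G_fam k)) = 3 * k + 6"
proof -
  have "card (\<Union>i\<in>{1..k}. {X i, Y i, Z i}) = (\<Sum>i\<in>{1..k}. card {X i, Y i, Z i})"
    by (rule card_UN_disjoint) auto
  also have "\<dots> = 3 * k" by simp
  finally show ?thesis
    unfolding verts_G_fam by (subst card_Un_disjoint) auto
qed

section \<open>An identifying code of size \<open>2 * k + 3\<close>\<close>

definition min_code :: "nat \<Rightarrow> vertex set" where
  "min_code k = {V 1, V 2, V 5} \<union> (\<Union>i\<in>{1..k}. {X i, Y i})"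

lemma card_min_code: "card (min_code k) = 2 * k + 3"
proof -
  have "card (\<Union>i\<in>{1..k}. {X i, Y i}) = (\<Sum>i\<in>{1..k}. card {X i, Y i})"
    by (rule card_UN_disjoint) auto
  also have "\<dots> = 2 * k" by simp
  finally show ?thesis
    unfolding min_code_def by (subst card_Un_disjoint) auto
qed

text \<open>The sets on the right are nonempty and pairwise distinct, so \<open>min_code k\<close>
  dominates and separates.\<close>

lemma I_set_min_code:
  "I_set (G_fam k) (min_code k) W = {V 1}"
  "I_set (G_fam k) (min_code k) (V 1) = {V 1, V 2, V 5}"
  "I_set (G_fam k) (min_code k) (V 2) = {V 1, V 2}"
  "I_set (G_fam k) (min_code k) (V 3) = {V 2}"
  "I_set (G_fam k) (min_code k) (V 4) = {V 5}"
  "I_set (G_fam k) (min_code k) (V 5) = {V 1, V 5}"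
  "i \<in> {1..k} \<Longrightarrow> I_set (G_fam k) (min_code k) (X i) = {X i}"
  "i \<in> {1..k} \<Longrightarrow> I_set (G_fam k) (min_code k) (Y i) = {Y i}"
  "i \<in> {1..k} \<Longrightarrow> I_set (G_fam k) (min_code k) (Z i) = {X i, Y i}"
  unfolding I_set_def by (simp_all only: closed_nbhd_G_fam) (auto simp: min_code_def)

lemma identifying_code_min_code: "identifying_code (G_fam k) (min_code k)"
  unfolding identifying_code_def
proof (intro conjI ballI impI)
  show "is_code (G_fam k) (min_code k)"
    by (auto simp: is_code_def min_code_def verts_G_fam)
next
  fix v assume "v \<in> verts (G_fam k)"
  then show "I_set (G_fam k) (min_code k) v \<noteq> {}"
    by (cases rule: verts_G_fam_cases) (simp_all only: I_set_min_code, simp_all)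
next
  fix u v
  assume u: "u \<in> verts (G_fam k)" and v: "v \<in> verts (G_fam k)" and "u \<noteq> v"
  show "I_set (G_fam k) (min_code k) u \<noteq> I_set (G_fam k) (min_code k) v"
    by (insert \<open>u \<noteq> v\<close>, rule verts_G_fam_cases[OF u]; rule verts_G_fam_cases[OF v];
        simp only: I_set_min_code; simp add: set_eq_subset)
qed

lemma identifying_code_verts_remove: "identifying_code (G_fam k) (verts (G_fam k) - {a})"
  unfolding identifying_code_def
proof (intro conjI ballI impI)
  have "V 1 \<in> verts (G_fam k)" "V 2 \<in> verts (G_fam k)"
    by (auto simp: verts_G_fam)
  then have "(if a = V 1 then V 2 else V 1) \<in> verts (G_fam k) - {a}" by auto
  then show "is_code (G_fam k) (verts (G_fam k) - {a})"
    by (auto simp: is_code_def)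
next
  have I: "I_set (G_fam k) (verts (G_fam k) - {a}) v = closed_nbhd (G_fam k) v - {a}" for v
    by (auto simp: I_set_def closed_nbhd_def)
  {
    fix v assume v: "v \<in> verts (G_fam k)"
    have "\<not> closed_nbhd (G_fam k) v \<subseteq> {a}"
      by (rule verts_G_fam_cases[OF v]; simp only: closed_nbhd_G_fam; auto)
    then show "I_set (G_fam k) (verts (G_fam k) - {a}) v \<noteq> {}"
      unfolding I by auto
  next
    fix u v
    assume u: "u \<in> verts (G_fam k)" and v: "v \<in> verts (G_fam k)" and "u \<noteq> v"
    \<comment> \<open>Two sets agree after deletion of \<open>a\<close> exactly if each lies in the
      other enlarged by \<open>a\<close>.\<close>
    have "\<not> (closed_nbhd (G_fam k) u \<subseteq> insert a (closed_nbhd (G_fam k) v) \<and>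
        closed_nbhd (G_fam k) v \<subseteq> insert a (closed_nbhd (G_fam k) u))"
      by (insert \<open>u \<noteq> v\<close>, rule verts_G_fam_cases[OF u]; rule verts_G_fam_cases[OF v];
          simp only: closed_nbhd_G_fam; auto)
    then have "closed_nbhd (G_fam k) u - {a} \<noteq> closed_nbhd (G_fam k) v - {a}"
      by blast
    then show "I_set (G_fam k) (verts (G_fam k) - {a}) u \<noteq> I_set (G_fam k) (verts (G_fam k) - {a}) v"
      unfolding I .
  }
qed

lemma not_always_forced_G_fam: "\<not> always_forced (G_fam k) a"
  using identifying_code_verts_remove[of k a] by (auto simp: always_forced_def)

section \<open>Lower bounds on the blocks of a code\<close>

text \<open>Separation means that \<open>S\<close> meets the symmetric difference of the two closed
  neighbourhoods; where that difference is small, it becomes a short disjunction of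
  memberships.\<close>

lemma code_constraints:
  assumes "identifying_code (G_fam k) S"
  shows dominates: "v \<in> verts (G_fam k) \<Longrightarrow> S \<inter> closed_nbhd (G_fam k) v \<noteq> {}"
    and separates: "u \<in> verts (G_fam k) \<Longrightarrow> v \<in> verts (G_fam k) \<Longrightarrow> u \<noteq> v \<Longrightarrow>
      S \<inter> closed_nbhd (G_fam k) u \<noteq> S \<inter> closed_nbhd (G_fam k) v"
  using assms by (auto simp: identifying_code_def I_set_def)

text \<open>Dominating \<open>X i\<close> and \<open>Y i\<close> and separating them from each other
  forbids any two vertices of the triple from being absent together. The neighbourhood of
  \<open>Z i\<close> exceeds that of \<open>X i\<close> by \<open>Y i\<close> and \<open>W\<close>
  only, and symmetrically for \<open>Y i\<close>.\<close>

lemma code_on_triple: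
  assumes S: "identifying_code (G_fam k) S" and i: "i \<in> {1..k}"
  shows "card (S \<inter> {X i, Y i, Z i}) \<ge> 2"
    and "W \<notin> S \<Longrightarrow> X i \<in> S \<and> Y i \<in> S"
proof -
  have v: "X i \<in> verts (G_fam k)" "Y i \<in> verts (G_fam k)" "Z i \<in> verts (G_fam k)"
    using i by (auto simp: verts_G_fam)
  note nb = closed_nbhd_G_fam(7-9)[OF i]
  have "X i \<in> S \<or> Z i \<in> S" "Y i \<in> S \<or> Z i \<in> S"
    using dominates[OF S v(1)] dominates[OF S v(2)] unfolding nb by auto
  moreover have "X i \<in> S \<or> Y i \<in> S"
    using separates[OF S v(1,2)] unfolding nb by auto
  ultimately show "card (S \<inter> {X i, Y i, Z i}) \<ge> 2"
    by (cases "X i \<in> S"; cases "Y i \<in> S"; cases "Z i \<in> S") (simp_all add: Int_insert_right)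
  show "X i \<in> S \<and> Y i \<in> S" if "W \<notin> S"
    using separates[OF S v(1,3)] separates[OF S v(2,3)] that unfolding nb by auto
qed

lemma code_on_cycle:
  assumes S: "identifying_code (G_fam k) S"
  shows "card (S \<inter> {V 1, V 2, V 3, V 4, V 5}) \<ge> 3"
    and "card (S \<inter> {V 1, V 2, V 3, V 4, V 5}) = 3 \<Longrightarrow> W \<notin> S \<Longrightarrow> (\<forall>i\<in>{1..k}. Z i \<notin> S)
      \<Longrightarrow> S \<inter> {V 1, V 2, V 3, V 4, V 5} = {V 1, V 2, V 5}"
proof -
  have v: "V 1 \<in> verts (G_fam k)" "V 2 \<in> verts (G_fam k)" "V 3 \<in> verts (G_fam k)"
    "V 4 \<in> verts (G_fam k)" "V 5 \<in> verts (G_fam k)" "W \<in> verts (G_fam k)"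
    by (auto simp: verts_G_fam)
  note nb = closed_nbhd_G_fam(1-6)
  have dom: "V 2 \<in> S \<or> V 3 \<in> S \<or> V 4 \<in> S" "V 3 \<in> S \<or> V 4 \<in> S \<or> V 5 \<in> S"
    using dominates[OF S v(3)] dominates[OF S v(4)] unfolding nb by auto
  have s23: "V 1 \<in> S \<or> V 4 \<in> S"
    using separates[OF S v(2,3)] unfolding nb by auto
  have s34: "V 2 \<in> S \<or> V 5 \<in> S"
    using separates[OF S v(3,4)] unfolding nb by auto
  have s45: "V 1 \<in> S \<or> V 3 \<in> S"
    using separates[OF S v(4,5)] unfolding nb by auto
  \<comment> \<open>Two vertices could meet the three pairs only as \<open>V 1\<close> with
    \<open>V 2\<close> or \<open>V 5\<close>, and each choice misses one of the triples in
    \<open>dom\<close>.\<close>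
  show "card (S \<inter> {V 1, V 2, V 3, V 4, V 5}) \<ge> 3"
    using dom s23 s34 s45
    by (cases "V 1 \<in> S"; cases "V 2 \<in> S"; cases "V 3 \<in> S"; cases "V 4 \<in> S"; cases "V 5 \<in> S")
       (simp_all add: Int_insert_right)
  assume c: "card (S \<inter> {V 1, V 2, V 3, V 4, V 5}) = 3" and W: "W \<notin> S"
    and Z: "\<forall>i\<in>{1..k}. Z i \<notin> S"
  have IW: "S \<inter> closed_nbhd (G_fam k) W = S \<inter> {V 1}"
    using W Z unfolding nb by auto
  have V1: "V 1 \<in> S"
    using dominates[OF S v(6)] unfolding IW by auto
  \<comment> \<open>The code sees \<open>W\<close> only through \<open>V 1\<close>, so
    \<open>V 2\<close> and \<open>V 5\<close> must each see a further vertex.\<close>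
  have "V 2 \<in> S \<or> V 3 \<in> S" "V 4 \<in> S \<or> V 5 \<in> S"
    using separates[OF S v(6,2)] separates[OF S v(6,5)] V1 unfolding IW unfolding nb by auto
  moreover have "V 3 \<in> S \<or> V 5 \<in> S" "V 2 \<in> S \<or> V 4 \<in> S"
    using separates[OF S v(1,2)] separates[OF S v(1,5)] W unfolding nb by auto
  \<comment> \<open>Besides \<open>V 1\<close> there is one of \<open>V 2\<close>,
    \<open>V 3\<close> and one of \<open>V 4\<close>, \<open>V 5\<close>. The other disjunctions
    exclude every choice but \<open>V 2\<close>, \<open>V 5\<close>; it is \<open>s34\<close> that
    excludes \<open>V 3\<close>, \<open>V 4\<close>.\<close>
  ultimately show "S \<inter> {V 1, V 2, V 3, V 4, V 5} = {V 1, V 2, V 5}"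
    using V1 c s34
    by (cases "V 2 \<in> S"; cases "V 3 \<in> S"; cases "V 4 \<in> S"; cases "V 5 \<in> S")
       (simp_all add: Int_insert_right)
qed

lemma card_code_split:
  assumes "S \<subseteq> verts (G_fam k)"
  shows "card S = card (S \<inter> {W}) + card (S \<inter> {V 1, V 2, V 3, V 4, V 5})
    + (\<Sum>i\<in>{1..k}. card (S \<inter> {X i, Y i, Z i}))"
proof -
  let ?C = "{V 1, V 2, V 3, V 4, V 5}"
  let ?T = "\<Union>i\<in>{1..k}. S \<inter> {X i, Y i, Z i}"
  have "S = (S \<inter> {W} \<union> S \<inter> ?C) \<union> ?T"
    using assms unfolding verts_G_fam by blast
  then have "card S = card ((S \<inter> {W} \<union> S \<inter> ?C) \<union> ?T)"
    by (rule arg_cong)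
  also have "\<dots> = card (S \<inter> {W} \<union> S \<inter> ?C) + card ?T"
    by (rule card_Un_disjoint) auto
  also have "card (S \<inter> {W} \<union> S \<inter> ?C) = card (S \<inter> {W}) + card (S \<inter> ?C)"
    by (rule card_Un_disjoint) auto
  also have "card ?T = (\<Sum>i\<in>{1..k}. card (S \<inter> {X i, Y i, Z i}))"
    by (rule card_UN_disjoint) auto
  finally show ?thesis .
qed

section \<open>Uniqueness of the minimum code\<close>

text \<open>Assuming an upper bound rather than minimality makes this yield both the minimality of
  \<open>min_code k\<close> and its uniqueness.\<close>

lemma small_code_eq_min_code:
  assumes S: "identifying_code (G_fam k) S" and le: "card S \<le> 2 * k + 3"
  shows "S = min_code k"
proof -
  let ?C = "{V 1, V 2, V 3, V 4, V 5}"
  let ?t = "\<lambda>i. card (S \<inter> {X i, Y i, Z i})"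
  have sub: "S \<subseteq> verts (G_fam k)"
    using S by (auto simp: identifying_code_def is_code_def)
  note split = card_code_split[OF sub]
  have t: "2 \<le> ?t i" if "i \<in> {1..k}" for i
    using code_on_triple(1)[OF S that] .
  have "(\<Sum>i\<in>{1..k}. 2) \<le> (\<Sum>i\<in>{1..k}. ?t i)"
    by (rule sum_mono) (rule t)
  then have sum: "2 * k \<le> (\<Sum>i\<in>{1..k}. ?t i)" by simp
  note C = code_on_cycle(1)[OF S]
  \<comment> \<open>The block bounds 0, 3 and \<open>2 * k\<close> already add up to the allowed
    total, so each is attained.\<close>
  have "card (S \<inter> {W}) = 0" and C3: "card (S \<inter> ?C) = 3" and sum2: "(\<Sum>i\<in>{1..k}. ?t i) = 2 * k"
    using split sum C le by linarith+
  then have W: "W \<notin> S" by (simp add: card_eq_0_iff)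
  have XY: "X i \<in> S" "Y i \<in> S" if "i \<in> {1..k}" for i
    using code_on_triple(2)[OF S that W] by auto
  have Z: "\<forall>i\<in>{1..k}. Z i \<notin> S"
  proof (intro ballI notI)
    fix i assume i: "i \<in> {1..k}" and "Z i \<in> S"
    \<comment> \<open>With \<open>X i\<close> and \<open>Y i\<close> present, \<open>Z i\<close>
      would be a third vertex of its triple and push the sum above \<open>2 * k\<close>.\<close>
    then have "2 < ?t i"
      using XY[OF i] by (simp add: Int_insert_right)
    then have "(\<Sum>i\<in>{1..k}. 2) < (\<Sum>i\<in>{1..k}. ?t i)"
      using i t by (intro sum_strict_mono_ex1) auto
    with sum2 show False by simp
  qed
  note cyc = code_on_cycle(2)[OF S C3 W Z]
  show ?thesis
  proof (intro set_eqI iffI)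
    fix v assume "v \<in> S"
    with sub have "v \<in> verts (G_fam k)" by blast
    then show "v \<in> min_code k"
      using \<open>v \<in> S\<close> W Z cyc unfolding min_code_def by (cases rule: verts_G_fam_cases) blast+
  next
    fix v assume "v \<in> min_code k"
    then show "v \<in> S"
      using XY cyc unfolding min_code_def by blast
  qed
qed

lemma minimum_identifying_code_G_fam_iff:
  "minimum_identifying_code (G_fam k) S \<longleftrightarrow> S = min_code k"
proof
  assume "minimum_identifying_code (G_fam k) S"
  then show "S = min_code k"
    using small_code_eq_min_code identifying_code_min_code card_min_code
    unfolding minimum_identifying_code_def by metis
next
  assume "S = min_code k"
  moreover have "card (min_code k) \<le> card T" if "identifying_code (G_fam k) T" for T
    using small_code_eq_min_code[OF that] card_min_code by (cases "card T \<le> 2 * k + 3") auto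
  ultimately show "minimum_identifying_code (G_fam k) S"
    using identifying_code_min_code by (simp add: minimum_identifying_code_def)
qed

text \<open>The converse direction is what makes the count of proper-min-forced vertices
  exact.\<close>

lemma proper_min_forced_G_fam_iff: "proper_min_forced (G_fam k) v \<longleftrightarrow> v \<in> min_code k"
  using unique_minimum_code_min_forced_iff[OF minimum_identifying_code_G_fam_iff]
    not_always_forced_G_fam
  by (simp add: proper_min_forced_def)

theorem mainTheorem2:
  fixes k :: nat
  assumes "k \<ge> 1"
  shows "simple_graph (G_fam k) \<and> closed_twin_free (G_fam k) \<and>
    proper_min_forced (G_fam k) (V 1) \<and>
    proper_min_forced (G_fam k) (V 2) \<and>
    proper_min_forced (G_fam k) (V 5) \<and>
    (\<forall>i\<in>{1..k}. proper_min_forced (G_fam k) (X i) \<and> proper_min_forced (G_fam k) (Y i)) \<and>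
    card (verts (G_fam k)) = 3 * k + 6 \<and>
    card {v \<in> verts (G_fam k). proper_min_forced (G_fam k) v} = 2 * k + 3 \<and>
    real (2 * k + 3) = 2 * real (card (verts (G_fam k))) / 3 - 1"
proof -
  have "{v \<in> verts (G_fam k). proper_min_forced (G_fam k) v} = min_code k"
    using identifying_code_min_code[of k] by (auto simp: proper_min_forced_G_fam_iff identifying_code_def is_code_def)
  moreover have "V 1 \<in> min_code k" "V 2 \<in> min_code k" "V 5 \<in> min_code k"
    "\<forall>i\<in>{1..k}. X i \<in> min_code k \<and> Y i \<in> min_code k"
    by (auto simp: min_code_def)
  moreover have "real (2 * k + 3) = 2 * real (card (verts (G_fam k))) / 3 - 1"
    by (simp add: card_verts_G_fam)
  ultimately show ?thesis
    using simple_graph_G_fam identifying_code_imp_closed_twin_free[OF identifying_code_min_code]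
    by (simp add: proper_min_forced_G_fam_iff card_verts_G_fam card_min_code)
qed

end
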